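(* Let $k^t,k^d\in\mathbb{N}$ and let $\alpha>0$ with $\frac1\alpha\in\mathbb{N}$. For every deterministic online policy $\mathrm{ALG}$ for the relief distribution problem there is an instance $I$ with $k^t$ trucks, $k^d$ drones and drone speed $\alpha$ such that $$\frac{\mathrm{ALG}(I)}{\mathrm{OPT}(I^* )}\ \ge\ \min\left\{2,\ 1+\left\lceil\frac{k^d}{k^t}\right\rceil\alpha\right\}.$$
   Context: Relief distribution problem (RDP). $\mathbb{N}=\{1,2,\dots\}$. An instance is $I=(k^t,k^d,\alpha,G,D)$: $k^t,k^d\in\mathbb{N}$ are the numbers of trucks and drones; $\alpha>0$ is the drone speed; $G=(V,E,c)$ is a finite connected undirected graph (not necessarily complete) with $V=\{v_0\}\cup C$, where $v_0$ is the depot and $C\neq\emptyset$ is the set of non-depot nodes; edge lengths $c(i,j)>0$ satisfy the triangle inequality; $D\subseteq C$ is the set of damaged nodes. For non-adjacent $i,j$, $c(i,j)$ is the shortest-path distance. A truck needs time $c(i,j)$ to traverse an edge, a drone needs $\frac1\alpha c(i,j)$. A tour is a closed walk in $G$ starting and ending at $v_0$ (possibly of length $0$); it visits all nodes lying on it. The makespan of a family of tours is the maximum duration of a tour. A feasible solution consists of $k^t$ truck tours and $k^d$ drone tours such that every node of $C$ is visited by some vehicle and every node of $D$ is visited by a truck. $\mathrm{OPT}(I^* )$ is the minimum makespan of a feasible solution ($I^*$ is the instance $I$ with $D$ known in advance). Online setting: initially everything except $D$ is known; whether $v\in C$ is damaged is revealed (to all vehicles, instantly) when some vehicle first arrives at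 $v$. A deterministic online policy $\mathrm{ALG}$ prescribes at every time, based only on the initially known data and the damage statuses revealed so far, how each vehicle acts (move along edges or wait), all vehicles starting at $v_0$ at time $0$, such that for every $D$ the executed tours form a feasible solution. $\mathrm{ALG}(I)$ is the time at which the last vehicle has returned to $v_0$. *)

theory Defs
  imports "HOL-Analysis.Analysis" "Graph_Theory.Graph_Theory"
begin

section \<open>Instances\<close>

text \<open>
  The record \<open>rdp\<close> holds the initially known data; an instance is an \<open>rdp\<close> together with the set
  of damaged nodes. Undirected graphs are symmetric loop-free digraphs (locale \<open>pair_graph\<close>), so
  every edge is a pair of opposite arcs of equal length. As graphs are finite, natural numbers
  serve as nodes.
\<close>

record rdp =
  trucks :: nat
  drones :: nat
  drone_speed :: real
  graph :: "nat pair_pre_digraph"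
  depot :: nat
  len :: "nat \<times> nat \<Rightarrow> real"

definition customers :: "rdp \<Rightarrow> nat set" where
  "customers N = pverts (graph N) - {depot N}"

text \<open>\<open>wf_digraph.\<mu>\<close> is the shortest-path distance; \<open>cost\<close> extends the edge lengths to all pairs of nodes.\<close>

definition cost :: "rdp \<Rightarrow> nat \<Rightarrow> nat \<Rightarrow> real" where
  "cost N u v =
     (if (u, v) \<in> parcs (graph N) then len N (u, v)
      else real_of_ereal (wf_digraph.\<mu> (with_proj (graph N)) (len N) u v))"

definition rdp_data :: "rdp \<Rightarrow> bool" where
  "rdp_data N \<longleftrightarrow>
     trucks N \<ge> 1 \<and> drones N \<ge> 1 \<and> drone_speed N > 0 \<and>
     pair_graph (graph N) \<and> Digraph_Component.connected (with_proj (graph N)) \<and>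
     depot N \<in> pverts (graph N) \<and> customers N \<noteq> {} \<and>
     (\<forall>(u, v) \<in> parcs (graph N). len N (u, v) > 0 \<and> len N (v, u) = len N (u, v)) \<and>
     (\<forall>u \<in> pverts (graph N). \<forall>v \<in> pverts (graph N). \<forall>w \<in> pverts (graph N).
        cost N u w \<le> cost N u v + cost N v w)"

definition rdp_instance :: "rdp \<Rightarrow> nat set \<Rightarrow> bool" where
  "rdp_instance N D \<longleftrightarrow> rdp_data N \<and> D \<subseteq> customers N"

datatype vehicle = Truck nat | Drone nat

definition truck_fleet :: "rdp \<Rightarrow> vehicle set" where
  "truck_fleet N = Truck ` {..<trucks N}"

definition fleet :: "rdp \<Rightarrow> vehicle set" where
  "fleet N = truck_fleet N \<union> Drone ` {..<drones N}"

fun speed :: "rdp \<Rightarrow> vehicle \<Rightarrow> real" where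
  "speed N (Truck _) = 1"
| "speed N (Drone _) = drone_speed N"

definition serves :: "rdp \<Rightarrow> nat set \<Rightarrow> (vehicle \<Rightarrow> nat set) \<Rightarrow> bool" where
  "serves N D visited \<longleftrightarrow>
     customers N \<subseteq> (\<Union>i \<in> fleet N. visited i) \<and> D \<subseteq> (\<Union>i \<in> truck_fleet N. visited i)"


section \<open>The offline optimum\<close>

definition tour :: "rdp \<Rightarrow> nat list \<Rightarrow> bool" where
  "tour N p \<longleftrightarrow> vwalk p (with_proj (graph N)) \<and> hd p = depot N \<and> last p = depot N"

definition duration :: "rdp \<Rightarrow> vehicle \<Rightarrow> nat list \<Rightarrow> real" where
  "duration N i p = (\<Sum>a\<leftarrow>vwalk_arcs p. len N a / speed N i)"

definition makespan :: "rdp \<Rightarrow> (vehicle \<Rightarrow> nat list) \<Rightarrow> real" where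
  "makespan N P = (MAX i \<in> fleet N. duration N i (P i))"

definition feasible :: "rdp \<Rightarrow> nat set \<Rightarrow> (vehicle \<Rightarrow> nat list) \<Rightarrow> bool" where
  "feasible N D P \<longleftrightarrow> (\<forall>i \<in> fleet N. tour N (P i)) \<and> serves N D (\<lambda>i. set (P i))"

text \<open>
  The infimum is attained: a feasible solution exists, and only finitely many tours have duration
  below a given bound.
\<close>

definition OPT :: "rdp \<Rightarrow> nat set \<Rightarrow> real" where
  "OPT N D = Inf {makespan N P | P. feasible N D P}"


section \<open>Online policies\<close>

text \<open>
  Vehicles move in the geometric realization of the graph. A position is given by its barycentric
  coordinates: \<open>on_edge u w \<theta>\<close> is the point of the edge \<open>uw\<close> that lies at the fraction \<open>\<theta>\<close> of the
  way from \<open>u\<close> to \<open>w\<close>.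
\<close>

type_synonym position = "nat \<Rightarrow> real"

definition on_edge :: "nat \<Rightarrow> nat \<Rightarrow> real \<Rightarrow> position" where
  "on_edge u w \<theta> = (\<lambda>v. (1 - \<theta>) * of_bool (v = u) + \<theta> * of_bool (v = w))"

definition at_node :: "nat \<Rightarrow> position" where
  "at_node u = (\<lambda>v. of_bool (v = u))"

datatype action = Wait | Move nat nat

text \<open>
  \<open>step N i a d p q\<close>: vehicle \<open>i\<close>, starting in \<open>p\<close> and performing \<open>a\<close> for \<open>d\<close> units of time, ends
  in \<open>q\<close>. \<open>Move u w\<close> means moving along the edge \<open>uw\<close> in the direction of \<open>w\<close>; the vehicle has to be
  on that edge, and cannot go on beyond \<open>w\<close>.
  Vehicles may stop and turn in the interior of an edge; compared with letting them only traverse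
  whole edges, this enlarges the class of policies.
\<close>

fun step :: "rdp \<Rightarrow> vehicle \<Rightarrow> action \<Rightarrow> real \<Rightarrow> position \<Rightarrow> position \<Rightarrow> bool" where
  "step N i Wait d p q \<longleftrightarrow> q = p"
| "step N i (Move u w) d p q \<longleftrightarrow>
     (u, w) \<in> parcs (graph N) \<and>
     (\<exists>\<theta>. 0 \<le> \<theta> \<and> \<theta> + speed N i * d / len N (u, w) \<le> 1 \<and>
          p = on_edge u w \<theta> \<and> q = on_edge u w (\<theta> + speed N i * d / len N (u, w)))"

type_synonym trajectory = "real \<Rightarrow> position"

definition visited_until :: "trajectory \<Rightarrow> real \<Rightarrow> nat set" where
  "visited_until x t = {v. \<exists>s. 0 \<le> s \<and> s \<le> t \<and> x s = at_node v}"

text \<open>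
  The damage statuses known at time \<open>t\<close> (\<open>None\<close>: not yet revealed). The times of the
  revelations need not be recorded: by \<open>execution_causal\<close> below they are determined by the policy
  and the statuses.
\<close>

definition revealed :: "rdp \<Rightarrow> nat set \<Rightarrow> (vehicle \<Rightarrow> trajectory) \<Rightarrow> real \<Rightarrow> nat \<Rightarrow> bool option" where
  "revealed N D x t =
     (\<lambda>v. if v \<in> customers N \<and> (\<exists>i \<in> fleet N. v \<in> visited_until (x i) t) then Some (v \<in> D) else None)"

text \<open>
  A policy maps the initially known data, the statuses revealed so far and the current time to
  an action of each vehicle.
\<close>

type_synonym policy = "rdp \<Rightarrow> (nat \<Rightarrow> bool option) \<Rightarrow> real \<Rightarrow> vehicle \<Rightarrow> action"

definition execution :: "policy \<Rightarrow> rdp \<Rightarrow> nat set \<Rightarrow> (vehicle \<Rightarrow> trajectory) \<Rightarrow> bool" where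
  "execution \<pi> N D x \<longleftrightarrow>
     (\<forall>i \<in> fleet N.
        x i 0 = at_node (depot N) \<and>
        (\<forall>v. continuous_on {0..} (\<lambda>t. x i t v)) \<and>
        (\<forall>t \<ge> 0. \<exists>\<epsilon> > 0. \<forall>d \<in> {0..\<epsilon>}.
           step N i (\<pi> N (revealed N D x t) t i) d (x i t) (x i (t + d))))"

definition returned :: "rdp \<Rightarrow> (vehicle \<Rightarrow> trajectory) \<Rightarrow> real \<Rightarrow> bool" where
  "returned N x T \<longleftrightarrow> 0 \<le> T \<and> (\<forall>i \<in> fleet N. \<forall>t \<ge> T. x i t = at_node (depot N))"

definition online_policy :: "policy \<Rightarrow> bool" where
  "online_policy \<pi> \<longleftrightarrow>
     (\<forall>N D. rdp_instance N D \<longrightarrow>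
        (\<exists>x. execution \<pi> N D x \<and>
             serves N D (\<lambda>i. \<Union>t \<in> {0..}. visited_until (x i) t) \<and>
             (\<exists>T. returned N x T)))"

text \<open>The completion time of the execution, which is unique on \<open>{0..}\<close>, see \<open>execution_unique\<close> below.\<close>

definition ALG :: "policy \<Rightarrow> rdp \<Rightarrow> nat set \<Rightarrow> real" where
  "ALG \<pi> N D = (THE T. \<exists>x. execution \<pi> N D x \<and> T = Inf {T. returned N x T})"

section \<open>Well-definedness of executions\<close>

lemma step_deterministic:
  assumes "pair_graph (graph N)" "step N i a d p q" "step N i a d p q'"
  shows "q = q'"
proof (cases a)
  case Wait
  with assms show ?thesis by simp
next
  case (Move u w)
  interpret pair_graph "graph N" by (rule assms(1))
  from Move assms(2) obtain \<theta> where 1: "(u, w) \<in> parcs (graph N)" "p = on_edge u w \<theta>"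
    "q = on_edge u w (\<theta> + speed N i * d / len N (u, w))" by auto
  from Move assms(3) obtain \<theta>' where 2: "p = on_edge u w \<theta>'"
    "q' = on_edge u w (\<theta>' + speed N i * d / len N (u, w))" by auto
  have "u \<noteq> w" using 1(1) no_loops by fastforce
  then have "on_edge u w \<eta> w = \<eta>" for \<eta> by (simp add: on_edge_def)
  with 1(2) 2(1) have "\<theta> = \<theta>'" by metis
  with 1(3) 2(2) show ?thesis by simp
qed

lemma execution_causal:
  assumes N: "rdp_data N"
    and x: "execution \<pi> N D x" and y: "execution \<pi> N D' y"
    and D: "\<And>i v. i \<in> fleet N \<Longrightarrow> v \<in> customers N \<Longrightarrow> v \<in> visited_until (x i) T \<Longrightarrow>
              v \<in> D \<longleftrightarrow> v \<in> D'"
    and i: "i \<in> fleet N" and t: "0 \<le> t" "t \<le> T"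
  shows "x i t = y i t"
proof -
  define A where "A t \<longleftrightarrow> (\<forall>i \<in> fleet N. \<forall>s. 0 \<le> s \<and> s \<le> t \<longrightarrow> x i s = y i s)" for t
  define S where "S = {t. 0 \<le> t \<and> t \<le> T \<and> \<not> A t}"
  have "S = {}"
  proof (rule ccontr)
    assume ne: "S \<noteq> {}"
    define m where "m = Inf S"
    have bdd: "bdd_below S" by (auto simp: S_def intro: bdd_belowI)
    have m0: "0 \<le> m" unfolding m_def using ne by (intro cInf_greatest) (auto simp: S_def)
    have mT: "m \<le> T"
    proof -
      obtain a where "a \<in> S" using ne by auto
      then have "m \<le> a" "a \<le> T" using cInf_lower[OF _ bdd] by (auto simp: m_def S_def)
      then show ?thesis by simp
    qed
    have before: "x i s = y i s" if "i \<in> fleet N" "0 \<le> s" "s < m" for i s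
    proof -
      have "s \<notin> S" using cInf_lower[OF _ bdd, of s] that by (auto simp: m_def)
      then show ?thesis using that mT by (auto simp: S_def A_def)
    qed
    have at: "x i m = y i m" if i: "i \<in> fleet N" for i
    proof (cases "m = 0")
      case True
      then show ?thesis using x y i by (auto simp: execution_def)
    next
      case False
      show ?thesis
      proof
        fix v
        let ?f = "\<lambda>t. x i t v - y i t v"
        have "continuous_on {0..} (\<lambda>t. x i t v)" "continuous_on {0..} (\<lambda>t. y i t v)"
          using x y i by (auto simp: execution_def)
        then have c: "continuous_on {0..} ?f" by (intro continuous_intros)
        have "closure {0..<m} = {0..m}" using m0 False by simp
        then have cont: "continuous_on (closure {0..<m}) ?f"
          using c by (auto intro: continuous_on_subset)
        have "?f m = 0"
        proof (rule continuous_constant_on_closure[OF cont])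
          show "\<And>s. s \<in> {0..<m} \<Longrightarrow> ?f s = 0" using before i by auto
          show "m \<in> closure {0..<m}" using m0 False by simp
        qed
        then show "x i m v = y i m v" by simp
      qed
    qed
    have upto: "x i s = y i s" if "i \<in> fleet N" "0 \<le> s" "s \<le> m" for i s
      using before at that by (cases "s = m") auto
    have vis: "visited_until (x i) m = visited_until (y i) m" if "i \<in> fleet N" for i
      using upto[OF that] by (auto simp: visited_until_def)
    have mono: "visited_until (x i) m \<subseteq> visited_until (x i) T" for i
      using mT unfolding visited_until_def by (auto intro: order_trans)
    have rev: "revealed N D x m = revealed N D' y m"
    proof
      fix v
      have "(\<exists>i \<in> fleet N. v \<in> visited_until (x i) m) \<longleftrightarrow> (\<exists>i \<in> fleet N. v \<in> visited_until (y i) m)"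
        using vis by simp
      moreover have "v \<in> D \<longleftrightarrow> v \<in> D'"
        if "v \<in> customers N" "\<exists>i \<in> fleet N. v \<in> visited_until (x i) m"
        using that mono D by blast
      ultimately show "revealed N D x m v = revealed N D' y m v"
        unfolding revealed_def by simp
    qed
    have adv: "\<exists>\<epsilon> > 0. \<forall>d \<in> {0..\<epsilon>}. x i (m + d) = y i (m + d)" if i: "i \<in> fleet N" for i
    proof -
      let ?a = "\<pi> N (revealed N D x m) m i"
      obtain e where e: "e > 0" "\<forall>d \<in> {0..e}. step N i ?a d (x i m) (x i (m + d))"
        using x i m0 unfolding execution_def by blast
      obtain e' where e': "e' > 0" "\<forall>d \<in> {0..e'}. step N i ?a d (x i m) (y i (m + d))"
        using y i m0 unfolding execution_def rev at[OF i] by blast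
      have "pair_graph (graph N)" using N by (simp add: rdp_data_def)
      then have "x i (m + d) = y i (m + d)" if "d \<in> {0..min e e'}" for d
        using e(2) e'(2) that by (intro step_deterministic[of N i ?a d "x i m"]) auto
      with e(1) e'(1) show ?thesis by (intro exI[of _ "min e e'"]) auto
    qed
    then have "\<exists>e. \<forall>i \<in> fleet N. e i > 0 \<and> (\<forall>d \<in> {0..e i}. x i (m + d) = y i (m + d))"
      by (intro bchoice) blast
    then obtain e where e: "\<And>i. i \<in> fleet N \<Longrightarrow> e i > 0"
      "\<And>i d. i \<in> fleet N \<Longrightarrow> d \<in> {0..e i} \<Longrightarrow> x i (m + d) = y i (m + d)" by blast
    define \<delta> where "\<delta> = Min (e ` fleet N)"
    have fin: "finite (fleet N)" "fleet N \<noteq> {}"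
      using i by (auto simp: fleet_def truck_fleet_def)
    have \<delta>: "\<delta> > 0" "\<And>i. i \<in> fleet N \<Longrightarrow> \<delta> \<le> e i"
      using fin e(1) by (auto simp: \<delta>_def)
    have A\<delta>: "A (m + \<delta>)"
      unfolding A_def
    proof (intro ballI allI impI)
      fix i s assume i: "i \<in> fleet N" and s: "0 \<le> s \<and> s \<le> m + \<delta>"
      show "x i s = y i s"
      proof (cases "s \<le> m")
        case True
        then show ?thesis using upto i s by simp
      next
        case False
        then show ?thesis using e(2)[OF i, of "s - m"] s \<delta>(2)[OF i] by simp
      qed
    qed
    have "m + \<delta> \<le> a" if "a \<in> S" for a
    proof (rule ccontr)
      assume "\<not> m + \<delta> \<le> a"
      with A\<delta> have "A a" unfolding A_def by auto
      with that show False by (simp add: S_def)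
    qed
    then have "m + \<delta> \<le> m" unfolding m_def using ne by (intro cInf_greatest) auto
    with \<delta>(1) show False by simp
  qed
  then show ?thesis using i t by (auto simp: S_def A_def)
qed

corollary execution_unique:
  assumes "rdp_data N" "execution \<pi> N D x" "execution \<pi> N D y" "i \<in> fleet N" "0 \<le> t"
  shows "x i t = y i t"
  by (rule execution_causal[OF assms(1-3) refl assms(4,5) order_refl])

lemma ALG_eq:
  assumes "rdp_data N" "execution \<pi> N D x"
  shows "ALG \<pi> N D = Inf {T. returned N x T}"
proof -
  have *: "returned N y = returned N x" if "execution \<pi> N D y" for y
  proof
    fix T
    have "y i t = x i t" if "i \<in> fleet N" "0 \<le> T" "T \<le> t" for i t
      by (rule execution_unique[OF assms(1) \<open>execution \<pi> N D y\<close> assms(2)]) (use that in auto)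
    then show "returned N y T = returned N x T"
      by (auto simp: returned_def)
  qed
  show ?thesis
    unfolding ALG_def
  proof (rule the_equality)
    show "\<exists>y. execution \<pi> N D y \<and> Inf {T. returned N x T} = Inf {T. returned N y T}"
      using assms(2) by blast
  next
    fix R
    assume "\<exists>y. execution \<pi> N D y \<and> R = Inf {T. returned N y T}"
    then obtain y where y: "execution \<pi> N D y" "R = Inf {T. returned N y T}" by blast
    show "R = Inf {T. returned N x T}" unfolding y(2) *[OF y(1)] ..
  qed
qed

end

theory Submission
  imports Defs
begin

text \<open>
  Let \<open>m = 1 / \<alpha>\<close>, and consider a star with \<open>kt * m + kd\<close> leaves at distance 1 from the depot. In
  time \<open>2 * m\<close> every truck serves any \<open>m\<close> leaves and every drone one leaf, so the optimum is at most
  \<open>2 * m\<close> as long as at most \<open>kt * m\<close> leaves are damaged. The adversary damages the leaves that are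
  first visited by one of \<open>s = min kd (kt * m)\<close> selected drones. A policy that finishes before
  time \<open>4 * m\<close> visits at most one leaf per drone, so all but \<open>kd - s\<close> leaves need a truck. Hence
  some truck has to visit at least \<open>(kt * m + s) / kt\<close> leaves, which takes it time 2 each.
\<close>

section \<open>Adaptive adversaries\<close>

definition first_visit :: "rdp \<Rightarrow> (vehicle \<Rightarrow> trajectory) \<Rightarrow> nat \<Rightarrow> real" where
  "first_visit N x v = Inf {t. 0 \<le> t \<and> (\<exists>i \<in> fleet N. x i t = at_node v)}"

lemma finite_fleet: "finite (fleet N)"
  by (simp add: fleet_def truck_fleet_def)

lemma at_node_eq_iff [simp]: "at_node u = at_node v \<longleftrightarrow> u = v"
  by (auto simp: at_node_def fun_eq_iff)

lemma first_visit_le: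
  "i \<in> fleet N \<Longrightarrow> 0 \<le> t \<Longrightarrow> x i t = at_node v \<Longrightarrow> first_visit N x v \<le> t"
  unfolding first_visit_def by (rule cInf_lower) (auto intro: bdd_belowI)

lemma execution_continuous:
  "execution \<pi> N D x \<Longrightarrow> i \<in> fleet N \<Longrightarrow> continuous_on {0..} (\<lambda>t. x i t v)"
  by (simp add: execution_def)

text \<open>Continuity is given only coordinate by coordinate, so the visiting times are written as
  an intersection of one closed set per coordinate.\<close>

lemma closed_visits:
  assumes "execution \<pi> N D x" "i \<in> fleet N"
  shows "closed {t. 0 \<le> t \<and> x i t = at_node v}"
proof -
  have "closed {t \<in> {0..}. x i t u = at_node v u}" for u
    by (rule continuous_closed_preimage_constant) (use execution_continuous[OF assms] in auto)
  then have "closed (\<Inter>u. {t \<in> {0..}. x i t u = at_node v u})" by blast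
  also have "(\<Inter>u. {t \<in> {0..}. x i t u = at_node v u}) = {t. 0 \<le> t \<and> x i t = at_node v}"
    by (auto simp: fun_eq_iff)
  finally show ?thesis .
qed

text \<open>The fleet is finite, so the visiting times of \<open>v\<close> form a closed nonempty
  set bounded below by 0; its infimum is a minimum.\<close>

lemma first_visit_attained:
  assumes "execution \<pi> N D x" "i \<in> fleet N" "0 \<le> t" "x i t = at_node v"
  shows "0 \<le> first_visit N x v \<and> (\<exists>i \<in> fleet N. x i (first_visit N x v) = at_node v)"
proof -
  let ?S = "{t. 0 \<le> t \<and> (\<exists>i \<in> fleet N. x i t = at_node v)}"
  have "?S = (\<Union>i \<in> fleet N. {t. 0 \<le> t \<and> x i t = at_node v})" by blast
  then have "closed ?S"
    using closed_visits[OF assms(1)] by (simp add: closed_UN finite_fleet)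
  moreover have "?S \<noteq> {}" using assms by blast
  moreover have "bdd_below ?S" by (auto intro: bdd_belowI)
  ultimately have "Inf ?S \<in> ?S" by (rule closed_contains_Inf[rotated 2])
  then show ?thesis by (simp add: first_visit_def)
qed

text \<open>The first visit in \<open>x\<close> happens by time \<open>T\<close> and is therefore
  shared by \<open>y\<close>; an earlier visit in \<open>y\<close> would be one in \<open>x\<close>
  as well.\<close>

lemma first_visit_cong:
  assumes x: "execution \<pi> N D x"
    and eq: "\<And>i t. i \<in> fleet N \<Longrightarrow> 0 \<le> t \<Longrightarrow> t \<le> T \<Longrightarrow> x i t = y i t"
    and v: "i \<in> fleet N" "0 \<le> s" "x i s = at_node v" and le: "first_visit N x v \<le> T"
  shows "first_visit N y v = first_visit N x v"
proof -
  obtain j where j: "0 \<le> first_visit N x v" "j \<in> fleet N" "x j (first_visit N x v) = at_node v"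
    using first_visit_attained[OF x v] by blast
  show ?thesis
    unfolding first_visit_def[of N y]
  proof (rule cInf_eq_minimum)
    show "first_visit N x v \<in> {t. 0 \<le> t \<and> (\<exists>i\<in>fleet N. y i t = at_node v)}"
      using j eq[OF j(2,1) le] by auto
    show "first_visit N x v \<le> t" if t: "t \<in> {t. 0 \<le> t \<and> (\<exists>i\<in>fleet N. y i t = at_node v)}" for t
    proof (rule ccontr)
      assume "\<not> first_visit N x v \<le> t"
      moreover obtain k where k: "k \<in> fleet N" "y k t = at_node v" "0 \<le> t" using t by auto
      ultimately show False
        using first_visit_le[of k N t x v] eq[of k t] le by auto
    qed
  qed
qed

text \<open>Sharpens \<open>execution_causal\<close>: a status revealed exactly at \<open>T\<close>
  affects only later motion. Causality gives agreement before \<open>T\<close>, and continuity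
  extends it to \<open>T\<close>. Thus statuses first revealed at \<open>T\<close> may be changed
  freely.\<close>

lemma execution_eq_upto:
  assumes N: "rdp_data N" and x: "execution \<pi> N D x" and y: "execution \<pi> N D' y"
    and eq: "\<And>v. v \<in> customers N \<Longrightarrow> first_visit N x v < T \<Longrightarrow> v \<in> D \<longleftrightarrow> v \<in> D'"
    and i: "i \<in> fleet N" and t: "0 \<le> t" "t \<le> T"
  shows "x i t = y i t"
proof -
  have before: "x i s = y i s" if "0 \<le> s" "s < T" for s
  proof (rule execution_causal[OF N x y _ i that(1) order_refl])
    fix j v assume "j \<in> fleet N" "v \<in> customers N" "v \<in> visited_until (x j) s"
    moreover from this have "first_visit N x v < T"
      using first_visit_le[of j N _ x v] that unfolding visited_until_def by force
    ultimately show "v \<in> D \<longleftrightarrow> v \<in> D'" using eq by blast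
  qed
  show ?thesis
  proof (cases "t < T \<or> t = 0")
    case True
    then show ?thesis using before t x y i by (auto simp: execution_def)
  next
    case False
    then have tT: "t = T" "T > 0" using t by auto
    show ?thesis
    proof
      fix v
      have cont: "continuous_on (closure {0..<T}) (\<lambda>t. x i t v - y i t v)"
        by (intro continuous_intros continuous_on_subset[OF execution_continuous[OF x i]]
            continuous_on_subset[OF execution_continuous[OF y i]]) (use tT in auto)
      have "x i T v - y i T v = 0"
        by (rule continuous_constant_on_closure[OF cont]) (use before tT in auto)
      then show "x i t v = y i t v" using tT by simp
    qed
  qed
qed

text \<open>
  An adversary may decide the status of a node at its first visit by any rule \<open>Q\<close> that looks only
  at the past. A consistent damage set is one whose first violation of the rule is latest:
  repairing the violations at that moment does not change anything that happened before.
\<close>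

lemma adaptive_adversary:
  fixes Q :: "(vehicle \<Rightarrow> trajectory) \<Rightarrow> nat \<Rightarrow> bool"
  assumes \<pi>: "online_policy \<pi>" and N: "rdp_data N"
    and Q: "\<And>x y v. first_visit N y v = first_visit N x v \<Longrightarrow>
      (\<And>i t. i \<in> fleet N \<Longrightarrow> 0 \<le> t \<Longrightarrow> t \<le> first_visit N x v \<Longrightarrow> x i t = y i t) \<Longrightarrow>
      Q x v \<longleftrightarrow> Q y v"
  obtains D x T where "D \<subseteq> customers N" "execution \<pi> N D x"
    "serves N D (\<lambda>i. \<Union>t \<in> {0..}. visited_until (x i) t)" "returned N x T"
    "\<And>v. v \<in> customers N \<Longrightarrow> v \<in> D \<longleftrightarrow> Q x v"
proof (rule ccontr)
  note result = that
  assume contr: "\<not> thesis"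
  have "\<forall>D \<in> Pow (customers N). \<exists>x. execution \<pi> N D x \<and>
             serves N D (\<lambda>i. \<Union>t \<in> {0..}. visited_until (x i) t) \<and> (\<exists>T. returned N x T)"
    using \<pi> N by (simp add: online_policy_def rdp_instance_def)
  \<comment> \<open>Fixing one execution \<open>X D\<close> per damage set makes first visits and
    violations functions of \<open>D\<close> alone.\<close>
  from bchoice[OF this] obtain X where X: "\<And>D. D \<subseteq> customers N \<Longrightarrow> execution \<pi> N D (X D)"
    "\<And>D. D \<subseteq> customers N \<Longrightarrow> serves N D (\<lambda>i. \<Union>t \<in> {0..}. visited_until (X D i) t)"
    "\<And>D. D \<subseteq> customers N \<Longrightarrow> \<exists>T. returned N (X D) T"
    by blast
  have visited: "\<exists>i \<in> fleet N. \<exists>s \<ge> 0. X D i s = at_node v"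
    if "D \<subseteq> customers N" "v \<in> customers N" for D v
  proof -
    have "v \<in> (\<Union>i \<in> fleet N. \<Union>t \<in> {0..}. visited_until (X D i) t)"
      using X(2)[OF that(1)] that(2) unfolding serves_def by blast
    then show ?thesis unfolding visited_until_def by blast
  qed
  define bad where "bad D = {v \<in> customers N. (v \<in> D) \<noteq> Q (X D) v}" for D
  define \<tau> where "\<tau> D = Min (first_visit N (X D) ` bad D)" for D
  have fin: "finite (customers N)"
  proof -
    interpret pair_graph "graph N" using N by (simp add: rdp_data_def)
    show ?thesis unfolding customers_def by (simp add: pair_finite_verts)
  qed
  then have finb: "finite (bad D)" for D by (simp add: bad_def)
  have ne: "bad D \<noteq> {}" if "D \<subseteq> customers N" for D
  proof
    assume "bad D = {}"
    then have "\<And>v. v \<in> customers N \<Longrightarrow> v \<in> D \<longleftrightarrow> Q (X D) v" by (auto simp: bad_def)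
    moreover obtain T where "returned N (X D) T" using X(3) \<open>D \<subseteq> customers N\<close> by blast
    ultimately show False using result[of D "X D" T] X(1,2)[OF that] contr that by blast
  qed
  have fin\<tau>: "finite (\<tau> ` Pow (customers N))" using fin by simp
  have "Max (\<tau> ` Pow (customers N)) \<in> \<tau> ` Pow (customers N)" by (rule Max_in[OF fin\<tau>]) auto
  then obtain D where D: "D \<subseteq> customers N" "\<tau> D = Max (\<tau> ` Pow (customers N))" by auto
  have D_max: "\<tau> D' \<le> \<tau> D" if "D' \<subseteq> customers N" for D'
    unfolding D(2) using that by (intro Max_ge[OF fin\<tau>]) auto
  \<comment> \<open>\<open>F\<close> collects the violations at the earliest violation time
    \<open>\<tau> D\<close>, and \<open>D'\<close> flips exactly these statuses; both executions
    then agree up to and including \<open>\<tau> D\<close>.\<close>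
  define F where "F = {v \<in> bad D. first_visit N (X D) v = \<tau> D}"
  define D' where "D' = (D - F) \<union> (F - D)"
  have D': "D' \<subseteq> customers N" using D(1) by (auto simp: D'_def F_def bad_def)
  have eq: "X D i t = X D' i t" if "i \<in> fleet N" "0 \<le> t" "t \<le> \<tau> D" for i t
    by (rule execution_eq_upto[OF N X(1)[OF D(1)] X(1)[OF D'] _ that])
      (auto simp: D'_def F_def)
  have "\<tau> D' \<in> first_visit N (X D') ` bad D'"
    unfolding \<tau>_def using finb ne[OF D'] by (intro Min_in) auto
  then obtain v where v: "v \<in> bad D'" "first_visit N (X D') v = \<tau> D'" by auto
  then have vC: "v \<in> customers N" by (simp add: bad_def)
  \<comment> \<open>By maximality of \<open>\<tau> D\<close>, the earliest violation
    \<open>v\<close> for \<open>D'\<close> falls into the period of agreement, so the rule gives the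
    same verdict on \<open>v\<close> in both executions.\<close>
  have le: "first_visit N (X D') v \<le> \<tau> D" using v(2) D_max[OF D'] by simp
  obtain i s where vis: "i \<in> fleet N" "s \<ge> 0" "X D' i s = at_node v" using visited[OF D' vC] by blast
  have fv: "first_visit N (X D) v = first_visit N (X D') v"
    by (rule first_visit_cong[OF X(1)[OF D'] _ vis le]) (use eq in auto)
  have QQ: "Q (X D) v \<longleftrightarrow> Q (X D') v"
    by (rule Q) (use fv le eq in auto)
  \<comment> \<open>If \<open>v\<close> already violated the rule for \<open>D\<close>, it lies in
    \<open>F\<close> and the flip repaired it; otherwise its status is unchanged and still obeys the
    rule.\<close>
  show False
  proof (cases "v \<in> bad D")
    case True
    then have "\<tau> D \<le> first_visit N (X D) v" unfolding \<tau>_def using finb by auto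
    then have "v \<in> F" using True fv le by (simp add: F_def)
    then show False using True v(1) QQ by (auto simp: bad_def D'_def)
  next
    case False
    then have "v \<notin> F" by (simp add: F_def)
    then show False using False v(1) QQ by (auto simp: bad_def D'_def)
  qed
qed

section \<open>Kinematics\<close>

text \<open>Continuous induction: if the supremum of \<open>S\<close> were below \<open>b\<close>,
  one could advance beyond it. The local hypothesis looks only to the right, because
  \<open>execution\<close> describes motion only forward in time.\<close>

lemma right_locally_decreasing_imp_le:
  fixes h :: "real \<Rightarrow> real"
  assumes ab: "a \<le> b" and cont: "continuous_on {a..b} h"
    and loc: "\<And>t. a \<le> t \<Longrightarrow> t < b \<Longrightarrow> \<exists>\<epsilon>>0. \<forall>d\<in>{0..\<epsilon>}. h (t + d) \<le> h t"
  shows "h b \<le> h a"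
proof -
  define S where "S = {a..b} \<inter> h -` {..h a}"
  have "closed S" unfolding S_def by (intro continuous_closed_preimage cont) auto
  moreover have "S \<noteq> {}" using ab by (auto simp: S_def)
  moreover have bdd: "bdd_above S" by (auto simp: S_def intro: bdd_aboveI)
  ultimately have M: "Sup S \<in> S" by (intro closed_contains_Sup)
  have "Sup S = b"
  proof (rule ccontr)
    assume "Sup S \<noteq> b"
    with M have *: "a \<le> Sup S" "Sup S < b" by (auto simp: S_def)
    then obtain \<epsilon> where \<epsilon>: "\<epsilon> > 0" "\<forall>d\<in>{0..\<epsilon>}. h (Sup S + d) \<le> h (Sup S)" using loc by blast
    define d where "d = min \<epsilon> (b - Sup S)"
    have "d > 0" "d \<in> {0..\<epsilon>}" using \<epsilon> * by (auto simp: d_def)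
    then have "h (Sup S + d) \<le> h (Sup S)" using \<epsilon>(2) by blast
    moreover have "h (Sup S) \<le> h a" using M by (simp add: S_def)
    ultimately have "h (Sup S + d) \<le> h a" by simp
    moreover have "a \<le> Sup S + d" "Sup S + d \<le> b" using \<open>d > 0\<close> * by (auto simp: d_def)
    ultimately have "Sup S + d \<in> S" unfolding S_def by simp
    then have "Sup S + d \<le> Sup S" by (rule cSup_upper[OF _ bdd])
    with \<open>d > 0\<close> show False by simp
  qed
  with M show ?thesis by (simp add: S_def)
qed

text \<open>Pigeonhole: of the cells of length \<open>\<delta>\<close> starting at \<open>a\<close>,
  each holds at most one point. The extra \<open>\<delta>\<close> on the right accounts for the last
  cell.\<close>

lemma card_separated_times:
  fixes S :: "real set"
  assumes fin: "finite S" and \<delta>: "\<delta> > 0" and ab: "a \<le> b" and sub: "S \<subseteq> {a..b}"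
    and sep: "\<And>s t. s \<in> S \<Longrightarrow> t \<in> S \<Longrightarrow> s < t \<Longrightarrow> s + \<delta> \<le> t"
  shows "real (card S) * \<delta> \<le> b - a + \<delta>"
proof -
  define f where "f t = \<lfloor>(t - a) / \<delta>\<rfloor>" for t
  have neq: "f s \<noteq> f t" if "s \<in> S" "t \<in> S" "s < t" for s t
  proof -
    have "(s - a + \<delta>) / \<delta> \<le> (t - a) / \<delta>"
      using sep[OF that] \<delta> by (intro divide_right_mono) auto
    then have "(t - a) / \<delta> \<ge> (s - a) / \<delta> + 1"
      using \<delta> by (simp add: add_divide_distrib)
    then show ?thesis unfolding f_def by linarith
  qed
  then have "inj_on f S" unfolding inj_on_def by (metis linorder_neqE)
  moreover have "f ` S \<subseteq> {0..\<lfloor>(b - a) / \<delta>\<rfloor>}"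
    using sub \<delta> by (force simp: f_def intro!: floor_mono divide_right_mono)
  ultimately have "card S \<le> card {0..\<lfloor>(b - a) / \<delta>\<rfloor>}"
    by (metis card_image card_mono finite_atLeastAtMost_int)
  then have "card S \<le> nat (\<lfloor>(b - a) / \<delta>\<rfloor> + 1)" by simp
  moreover have "0 \<le> \<lfloor>(b - a) / \<delta>\<rfloor>" using ab \<delta> by simp
  ultimately have "int (card S) \<le> \<lfloor>(b - a) / \<delta>\<rfloor> + 1" by linarith
  then have "real (card S) \<le> of_int \<lfloor>(b - a) / \<delta>\<rfloor> + 1" by linarith
  also have "\<dots> \<le> (b - a) / \<delta> + 1" by simp
  also have "\<dots> = (b - a + \<delta>) / \<delta>" using \<delta> by (simp add: add_divide_distrib)
  finally show ?thesis using \<delta> by (simp only: pos_le_divide_eq)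
qed

section \<open>Stars\<close>

definition star :: "nat \<Rightarrow> nat \<Rightarrow> real \<Rightarrow> nat \<Rightarrow> rdp" where
  "star kt kd \<alpha> n =
     \<lparr>trucks = kt, drones = kd, drone_speed = \<alpha>,
      graph = \<lparr>pverts = {..n}, parcs = {0} \<times> {1..n} \<union> {1..n} \<times> {0}\<rparr>,
      depot = 0, len = (\<lambda>_. 1)\<rparr>"

lemma star_simps [simp]:
  "trucks (star kt kd \<alpha> n) = kt" "drones (star kt kd \<alpha> n) = kd"
  "drone_speed (star kt kd \<alpha> n) = \<alpha>" "depot (star kt kd \<alpha> n) = 0"
  "len (star kt kd \<alpha> n) = (\<lambda>_. 1)"
  "pverts (graph (star kt kd \<alpha> n)) = {..n}"
  "parcs (graph (star kt kd \<alpha> n)) = {0} \<times> {1..n} \<union> {1..n} \<times> {0}"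
  by (simp_all add: star_def)

lemma customers_star [simp]: "customers (star kt kd \<alpha> n) = {1..n}"
  by (auto simp: customers_def)

lemma fleet_star: "fleet (star kt kd \<alpha> n) = Truck ` {..<kt} \<union> Drone ` {..<kd}"
  and truck_fleet_star: "truck_fleet (star kt kd \<alpha> n) = Truck ` {..<kt}"
  by (simp_all add: fleet_def truck_fleet_def)

lemma pair_graph_star: "pair_graph (graph (star kt kd \<alpha> n))"
proof unfold_locales
  show "symmetric (with_proj (graph (star kt kd \<alpha> n)))"
    by (auto simp: symmetric_def sym_def)
qed auto

text \<open>Needed for the triangle inequality in \<open>rdp_data\<close>, which involves
  shortest-path distances. Distinct leaves are joined through the depot, and a shorter walk would
  make them adjacent.\<close>

lemma cost_star:
  assumes "u \<le> n" "w \<le> n"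
  shows "cost (star kt kd \<alpha> n) u w = (if u = w then 0 else if u = 0 \<or> w = 0 then 1 else 2)"
proof (cases "u \<noteq> w \<and> (u = 0 \<or> w = 0)")
  case True
  then show ?thesis using assms by (auto simp: cost_def)
next
  case False
  let ?G = "graph (star kt kd \<alpha> n)"
  interpret pair_graph ?G by (rule pair_graph_star)
  have na: "(u, w) \<notin> parcs ?G" using False by auto
  define d :: nat where "d = (if u = w then 0 else 2)"
  define p where "p = (if u = w then [] else [(u, 0), (0, w)])"
  have p: "awalk u p w" "length p = d"
    using assms False by (auto simp: awalk_def p_def d_def)
  have awc: "awalk_cost (\<lambda>_. 1) q = real (length q)" for q :: "(nat \<times> nat) list"
    by (induction q) (auto simp: awalk_cost_def)
  have lower: "d \<le> length q" if q: "awalk u q w" for q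
  proof (rule ccontr)
    assume "\<not> d \<le> length q"
    then have "u \<noteq> w" "length q < 2" by (auto simp: d_def split: if_splits)
    moreover from this obtain e where "q = [e]"
      using q by (cases q; cases "tl q") (auto simp: awalk_def)
    ultimately have "(u, w) \<in> parcs ?G" using q by (auto simp: awalk_def)
    with na show False by blast
  qed
  have "\<mu> (\<lambda>_. 1) u w = ereal d"
    unfolding \<mu>_def
  proof (rule antisym)
    show "(INF q\<in>{q. awalk u q w}. ereal (awalk_cost (\<lambda>_. 1) q)) \<le> ereal d"
      using p by (intro INF_lower2[of p]) (auto simp: awc)
    show "ereal d \<le> (INF q\<in>{q. awalk u q w}. ereal (awalk_cost (\<lambda>_. 1) q))"
      using lower by (intro INF_greatest) (auto simp: awc)
  qed
  then show ?thesis using na False by (auto simp: cost_def d_def)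
qed

lemma connected_star: "Digraph_Component.connected (with_proj (graph (star kt kd \<alpha> n)))"
proof -
  let ?G = "with_proj (graph (star kt kd \<alpha> n))"
  interpret pair_graph "graph (star kt kd \<alpha> n)" by (rule pair_graph_star)
  have to: "u \<rightarrow>\<^sup>*\<^bsub>?G\<^esub> 0" and fro: "0 \<rightarrow>\<^sup>*\<^bsub>?G\<^esub> u" if "u \<le> n" for u
    using that by (cases "u = 0"; auto)+
  have "strongly_connected ?G"
    unfolding strongly_connected_def using reachable_trans[OF to fro] by auto
  then show ?thesis
    by (auto simp: connected_def strongly_connected_def intro: reachable_mk_symmetricI)
qed

lemma rdp_data_star:
  assumes "kt \<ge> 1" "kd \<ge> 1" "\<alpha> > 0" "n \<ge> 1"
  shows "rdp_data (star kt kd \<alpha> n)"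
  unfolding rdp_data_def
proof (intro conjI ballI)
  let ?N = "star kt kd \<alpha> n"
  show "cost ?N u w \<le> cost ?N u v + cost ?N v w"
    if "u \<in> pverts (graph ?N)" "v \<in> pverts (graph ?N)" "w \<in> pverts (graph ?N)" for u v w
    using that by (simp add: cost_star)
qed (use assms pair_graph_star connected_star in auto)


subsection \<open>Movement in a star\<close>

text \<open>
  Only the depot and one leaf have a positive coordinate, so no two leaf coordinates change at the
  same time.
\<close>

lemma star_step_rate:
  assumes "step (star kt kd \<alpha> n) i act d p q" "0 \<le> d" "0 \<le> speed (star kt kd \<alpha> n) i"
    and "0 < u" "0 < v" "u \<noteq> v" "\<bar>a\<bar> \<le> 1" "\<bar>b\<bar> \<le> 1"
  shows "a * q u + b * q v \<le> a * p u + b * p v + speed (star kt kd \<alpha> n) i * d"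
proof (cases act)
  case Wait
  then show ?thesis using assms by simp
next
  case (Move y z)
  define r where "r = speed (star kt kd \<alpha> n) i * d"
  have r: "0 \<le> r" using assms by (simp add: r_def)
  have c: "c * r \<le> r" "- (c * r) \<le> r" if "\<bar>c\<bar> \<le> 1" for c
    using mult_right_mono[of c 1 r] mult_right_mono[of "-c" 1 r] that r by auto
  obtain \<theta> where \<theta>: "p = on_edge y z \<theta>" "q = on_edge y z (\<theta> + r)"
    and yz: "y = 0 \<and> 0 < z \<or> z = 0 \<and> 0 < y"
    using assms(1) Move by (auto simp: r_def)
  show ?thesis
    using c[OF assms(7)] c[OF assms(8)] r yz assms(4-6) unfolding \<theta> r_def[symmetric]
    by (auto simp: on_edge_def algebra_simps)
qed

text \<open>Integrates the local rate. The coefficients \<open>(1, 0)\<close>,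
  \<open>(-1, 0)\<close> and \<open>(-1, 1)\<close> yield the travel times from the depot to a leaf,
  back, and between leaves; a second index with coefficient 0 is a mere dummy.\<close>

lemma star_rate:
  assumes x: "execution \<pi> (star kt kd \<alpha> n) D x" and i: "i \<in> fleet (star kt kd \<alpha> n)"
    and \<sigma>: "0 \<le> speed (star kt kd \<alpha> n) i"
    and st: "0 \<le> s" "s \<le> t" and uv: "0 < u" "0 < v" "u \<noteq> v" "\<bar>a\<bar> \<le> 1" "\<bar>b\<bar> \<le> 1"
  shows "a * x i t u + b * x i t v \<le> a * x i s u + b * x i s v + speed (star kt kd \<alpha> n) i * (t - s)"
proof -
  let ?\<sigma> = "speed (star kt kd \<alpha> n) i"
  \<comment> \<open>Subtracting the allowed increase \<open>?\<sigma> * t\<close> turns the rate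
    bound into local monotonicity.\<close>
  let ?h = "\<lambda>t. a * x i t u + b * x i t v - ?\<sigma> * t"
  have "?h t \<le> ?h s"
  proof (rule right_locally_decreasing_imp_le[OF st(2)])
    show "continuous_on {s..t} ?h"
      by (intro continuous_intros continuous_on_subset[OF execution_continuous[OF x i]])
        (use st in auto)
    fix r assume r: "s \<le> r"
    then obtain \<epsilon> where \<epsilon>: "\<epsilon> > 0" "\<And>d. d \<in> {0..\<epsilon>} \<Longrightarrow> step (star kt kd \<alpha> n) i
        (\<pi> (star kt kd \<alpha> n) (revealed (star kt kd \<alpha> n) D x r) r i) d (x i r) (x i (r + d))"
      using x i st unfolding execution_def by (meson order_trans)
    have "?h (r + d) \<le> ?h r" if "d \<in> {0..\<epsilon>}" for d
      using star_step_rate[OF \<epsilon>(2)[OF that] _ \<sigma> uv] that by (simp add: algebra_simps)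
    then show "\<exists>\<epsilon>>0. \<forall>d\<in>{0..\<epsilon>}. ?h (r + d) \<le> ?h r" using \<epsilon>(1) by blast
  qed
  then show ?thesis by (simp add: algebra_simps)
qed

context
  fixes \<pi> kt kd \<alpha> n D x i \<sigma>
  assumes x: "execution \<pi> (star kt kd \<alpha> n) D x" and i: "i \<in> fleet (star kt kd \<alpha> n)"
    and \<sigma>: "\<sigma> = speed (star kt kd \<alpha> n) i" and pos: "0 < \<sigma>"
begin

lemma star_outbound:
  assumes "0 \<le> t" "x i t = at_node v" "0 < v"
  shows "1 \<le> \<sigma> * t"
proof -
  have "x i 0 = at_node 0" using x i by (simp add: execution_def)
  then show ?thesis
    using star_rate[OF x i _ order_refl assms(1), of v "Suc v" 1 0] assms pos \<sigma>
    by (simp add: at_node_def)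
qed

lemma star_inbound:
  assumes "0 \<le> t" "t \<le> T" "x i t = at_node v" "0 < v" "x i T = at_node 0"
  shows "1 \<le> \<sigma> * (T - t)"
  using star_rate[OF x i _ assms(1,2), of v "Suc v" "-1" 0] assms pos \<sigma>
  by (simp add: at_node_def)

lemma star_leaf_to_leaf:
  assumes "0 \<le> s" "s \<le> t" "x i s = at_node u" "x i t = at_node v" "0 < u" "0 < v" "u \<noteq> v"
  shows "2 \<le> \<sigma> * (t - s)"
  using star_rate[OF x i _ assms(1,2) assms(5-7), of "-1" 1] assms pos \<sigma>
  by (simp add: at_node_def)

text \<open>No leaf is reached before \<open>1 / \<sigma>\<close>, and visits to different leaves
  are \<open>2 / \<sigma>\<close> apart, so \<open>card_separated_times\<close> applies on
  \<open>{1 / \<sigma>..b}\<close>. The time \<open>b\<close> bounds the visits only, without the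
  way back.\<close>

lemma star_card_visited:
  assumes V: "finite V" "0 \<notin> V" and b: "0 \<le> b"
    and vis: "\<And>v. v \<in> V \<Longrightarrow> \<exists>t. 0 \<le> t \<and> t \<le> b \<and> x i t = at_node v"
  shows "2 * real (card V) \<le> \<sigma> * b + 1"
proof (cases "V = {}")
  case True
  then show ?thesis using b pos by simp
next
  case False
  from bchoice[of V "\<lambda>v t. 0 \<le> t \<and> t \<le> b \<and> x i t = at_node v"] vis
  obtain f where f: "\<And>v. v \<in> V \<Longrightarrow> 0 \<le> f v \<and> f v \<le> b \<and> x i (f v) = at_node v" by blast
  have V0: "0 < v" if "v \<in> V" for v using V(2) that by (cases v) auto
  have inj: "inj_on f V" using f by (metis at_node_eq_iff inj_onI)
  have lo: "1 / \<sigma> \<le> f v" if "v \<in> V" for v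
    using star_outbound[of "f v" v] f[OF that] V0[OF that] pos by (simp add: field_simps)
  have sep: "s + 2 / \<sigma> \<le> t" if st: "s \<in> f ` V" "t \<in> f ` V" "s < t" for s t
  proof -
    obtain u v where uv: "u \<in> V" "v \<in> V" "s = f u" "t = f v" using st by auto
    then have "2 \<le> \<sigma> * (t - s)"
      using star_leaf_to_leaf[of s t u v] f[OF uv(1)] f[OF uv(2)] V0[OF uv(1)] V0[OF uv(2)] st(3)
      by (cases "u = v") auto
    then show ?thesis using pos by (simp add: field_simps)
  qed
  have sub: "f ` V \<subseteq> {1 / \<sigma>..b}" using lo f by auto
  then have ab: "1 / \<sigma> \<le> b" using False by force
  have "real (card (f ` V)) * (2 / \<sigma>) \<le> b - 1 / \<sigma> + 2 / \<sigma>"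
    by (rule card_separated_times) (use V(1) pos ab sub sep in auto)
  then show ?thesis using pos by (simp add: card_image[OF inj] field_simps)
qed

end


subsection \<open>Offline tours in a star\<close>

primrec excursions :: "nat list \<Rightarrow> nat list" where
  "excursions [] = [0]"
| "excursions (v # L) = 0 # v # excursions L"

lemma hd_excursions [simp]: "hd (excursions L) = 0" "excursions L \<noteq> []"
  by (cases L; simp)+

lemma set_excursions [simp]: "set (excursions L) = insert 0 (set L)"
  by (induction L) auto

lemma last_excursions [simp]: "last (excursions L) = 0"
  by (induction L) auto

lemma tour_excursions:
  assumes "set L \<subseteq> {1..n}"
  shows "tour (star kt kd \<alpha> n) (excursions L)"
proof -
  have "set (vwalk_arcs (excursions L)) \<subseteq> {0} \<times> {1..n} \<union> {1..n} \<times> {0}"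
    using assms by (induction L) auto
  then show ?thesis using assms by (auto simp: tour_def vwalk_def)
qed

lemma duration_excursions:
  "duration (star kt kd \<alpha> n) i (excursions L) = 2 * real (length L) / speed (star kt kd \<alpha> n) i"
  by (induction L) (auto simp: duration_def add_divide_distrib algebra_simps)

text \<open>Whoever visits leaf 1 traverses an edge of length 1 at speed at most 1. This crude bound
  makes the infimum in \<open>OPT\<close> a positive real number that one can divide by.\<close>

lemma makespan_star_ge_1:
  assumes "0 < \<alpha>" "\<alpha> \<le> 1" "1 \<le> n" and P: "feasible (star kt kd \<alpha> n) D P"
  shows "1 \<le> makespan (star kt kd \<alpha> n) P"
proof -
  let ?N = "star kt kd \<alpha> n"
  have "1 \<in> customers ?N" using assms by simp
  then obtain i where i: "i \<in> fleet ?N" "1 \<in> set (P i)"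
    using P unfolding feasible_def serves_def by blast
  then have "tour ?N (P i)" using P by (simp add: feasible_def)
  then have "hd (P i) = 0" by (simp add: tour_def)
  then obtain y ys where Pi: "P i = 0 # y # ys"
    using i(2) by (cases "P i"; cases "tl (P i)") auto
  have \<sigma>: "0 < speed ?N i" "speed ?N i \<le> 1" using assms by (cases i; simp)+
  have "0 \<le> (\<Sum>a\<leftarrow>vwalk_arcs (y # ys). len ?N a / speed ?N i)"
    using \<sigma> by (intro sum_list_nonneg) auto
  then have "1 \<le> duration ?N i (P i)"
    using \<sigma> unfolding Pi duration_def by (simp add: field_simps add_increasing2)
  also have "\<dots> \<le> makespan ?N P"
    unfolding makespan_def using i(1) finite_fleet by (intro Max_ge) auto
  finally show ?thesis .
qed

lemma OPT_star:
  assumes kt: "1 \<le> kt" and kd: "1 \<le> kd" and m: "1 \<le> m"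
    and n: "n = kt * m + kd" and D: "D \<subseteq> {1..n}" "card D \<le> kt * m"
  shows "1 \<le> OPT (star kt kd (1 / real m) n) D" "OPT (star kt kd (1 / real m) n) D \<le> 2 * real m"
proof -
  let ?N = "star kt kd (1 / real m) n"
  \<comment> \<open>Padding \<open>D\<close> to exactly \<open>kt * m\<close> leaves gives every
    truck \<open>m\<close> leaves and leaves exactly one for each drone.\<close>
  obtain A where A: "D \<subseteq> A" "A \<subseteq> {1..n}" "card A = kt * m"
    using exists_subset_between[of D "kt * m" "{1..n}"] D n by auto
  have fin: "finite A" "finite ({1..n} - A)" using A(2) finite_subset by auto
  have "card ({1..n} - A) = kd" using A n by (simp add: card_Diff_subset fin)
  then obtain f g where f: "f ` {0..<kt * m} = A" and g: "g ` {0..<kd} = {1..n} - A"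
    using ex_bij_betw_nat_finite[OF fin(1)] ex_bij_betw_nat_finite[OF fin(2)] A(3)
    by (metis bij_betw_imp_surj_on)
  \<comment> \<open>Truck \<open>k\<close> takes the \<open>k\<close>-th block of \<open>m\<close>
    leaves in the enumeration \<open>f\<close> of \<open>A\<close>; a drone of speed
    \<open>1 / m\<close> needs \<open>2 * m\<close> for its single leaf.\<close>
  define L where "L i = (case i of Truck k \<Rightarrow> map f [k * m..<k * m + m] | Drone j \<Rightarrow> [g j])" for i
  define P where "P i = excursions (L i)" for i
  have block: "{k * m..<k * m + m} \<subseteq> {0..<kt * m}" if "k < kt" for k
    using mult_le_mono1[of "Suc k" kt m] that by auto
  have L: "set (L i) \<subseteq> {1..n}" if "i \<in> fleet ?N" for i
  proof (cases i)
    case (Truck k)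
    then have "set (L i) \<subseteq> f ` {0..<kt * m}"
      using that block[of k] by (auto simp: L_def fleet_star)
    then show ?thesis using f A(2) by blast
  next
    case (Drone j)
    then have "set (L i) \<subseteq> g ` {0..<kd}" using that by (auto simp: L_def fleet_star)
    then show ?thesis using g by blast
  qed
  have dur: "duration ?N i (P i) \<le> 2 * real m" for i
    unfolding P_def duration_excursions using m by (cases i) (auto simp: L_def)
  have trucks: "A \<subseteq> (\<Union>i \<in> truck_fleet ?N. set (P i))"
  proof
    fix v assume "v \<in> A"
    then obtain q where q: "q < kt * m" "v = f q" using f by force
    then have "q div m < kt" by (simp add: less_mult_imp_div_less)
    then have "Truck (q div m) \<in> truck_fleet ?N" by (simp add: truck_fleet_star)
    moreover have "q \<in> {q div m * m..<q div m * m + m}"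
      using m dividend_less_div_times[of m q] by (simp add: add.commute)
    then have "v \<in> set (P (Truck (q div m)))" using q(2) by (auto simp: P_def L_def)
    ultimately show "v \<in> (\<Union>i \<in> truck_fleet ?N. set (P i))" by blast
  qed
  have "serves ?N D (\<lambda>i. set (P i))"
    unfolding serves_def
  proof
    have "{1..n} - A \<subseteq> (\<Union>i \<in> fleet ?N. set (P i))"
      unfolding g[symmetric] by (force simp: fleet_star P_def L_def)
    then show "customers ?N \<subseteq> (\<Union>i \<in> fleet ?N. set (P i))"
      using trucks unfolding fleet_def by auto
    show "D \<subseteq> (\<Union>i \<in> truck_fleet ?N. set (P i))" using trucks A(1) by simp
  qed
  then have P: "feasible ?N D P"
    unfolding feasible_def P_def using tour_excursions[OF L] by simp
  have ge: "1 \<le> r" if "r \<in> {makespan ?N P | P. feasible ?N D P}" for r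
    using that makespan_star_ge_1[of "1 / real m" n kt kd D] m kd n by auto
  show "1 \<le> OPT ?N D"
    unfolding OPT_def using P ge by (intro cInf_greatest) auto
  have "OPT ?N D \<le> makespan ?N P"
    unfolding OPT_def using P ge by (intro cInf_lower) (auto intro!: bdd_belowI[of _ 1])
  also have "\<dots> \<le> 2 * real m"
    unfolding makespan_def using dur kt
    by (intro Max.boundedI) (auto simp: finite_fleet fleet_star lessThan_empty_iff)
  finally show "OPT ?N D \<le> 2 * real m" .
qed


section \<open>The lower bound\<close>

theorem lemma24:
  fixes kt kd :: nat and \<alpha> :: real and \<pi> :: policy
  assumes "kt \<ge> 1" and "kd \<ge> 1"
    and "\<alpha> > 0" and "1 / \<alpha> \<in> \<nat>"
    and "online_policy \<pi>"
  shows "\<exists>N D. rdp_instance N D \<and> trucks N = kt \<and> drones N = kd \<and> drone_speed N = \<alpha> \<and>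
           ALG \<pi> N D / OPT N D \<ge> min 2 (1 + of_int \<lceil>real kd / real kt\<rceil> * \<alpha>)"
proof -
  obtain m :: nat where "1 / \<alpha> = real m" using assms(4) by (auto elim: Nats_cases)
  then have \<alpha>: "\<alpha> = 1 / real m" and m: "1 \<le> m"
    using assms(3) by (auto simp: divide_eq_eq eq_divide_eq mult.commute Suc_le_eq intro: gr0I)
  define n where "n = kt * m + kd"
  define N where "N = star kt kd \<alpha> n"
  \<comment> \<open>The cap \<open>kt * m\<close> keeps the damaged leaves few enough for
    \<open>OPT_star\<close>.\<close>
  define s where "s = min kd (kt * m)"
  \<comment> \<open>A drone reaches only one leaf before time \<open>3 * m\<close>, which bounds the number of damaged leaves;
    one that reaches a leaf later is not back before time \<open>4 * m\<close>.
    For a node that is never visited, \<open>first_visit\<close> is the junk value \<open>Inf {}\<close>, possibly negative.\<close>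
  define Q where "Q x v \<longleftrightarrow> 0 \<le> first_visit N x v \<and> first_visit N x v < 3 * real m \<and>
    (\<forall>i \<in> fleet N - Drone ` {..<s}. x i (first_visit N x v) \<noteq> at_node v)" for x v
  have n: "1 \<le> n" using assms(2) by (simp add: n_def)
  have N: "rdp_data N" unfolding N_def using assms n by (intro rdp_data_star) auto
  have customers: "customers N = {1..n}" by (simp add: N_def)
  have Drone: "Drone j \<in> fleet N" if "j < kd" for j using that by (simp add: N_def fleet_star)
  have Truck: "Truck k \<in> fleet N" if "k < kt" for k using that by (simp add: N_def fleet_star)
  have Q_causal: "Q x v \<longleftrightarrow> Q y v"
    if "first_visit N y v = first_visit N x v"
      "\<And>i t. i \<in> fleet N \<Longrightarrow> 0 \<le> t \<Longrightarrow> t \<le> first_visit N x v \<Longrightarrow> x i t = y i t" for x y v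
    using that by (auto simp: Q_def)
  obtain D x T0 where DC: "D \<subseteq> customers N" and x: "execution \<pi> N D x"
    and serves: "serves N D (\<lambda>i. \<Union>t \<in> {0..}. visited_until (x i) t)" and T0: "returned N x T0"
    and DQC: "\<And>v. v \<in> customers N \<Longrightarrow> v \<in> D \<longleftrightarrow> Q x v"
  proof (rule adaptive_adversary[where Q = Q, OF assms(5) N], goal_cases)
    case (1 x y v)
    show ?case by (rule Q_causal[OF 1(2,3)])
  qed (rule that)
  note D = DC[unfolded customers] and DQ = DQC[unfolded customers]
  note x' = x[unfolded N_def]

  \<comment> \<open>Leaves within reach of a single drone before time \<open>3 * m\<close>\<close>
  define W where "W j = {v \<in> {1..n}. \<exists>t \<ge> 0. t < 3 * real m \<and> x (Drone j) t = at_node v}" for j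
  have W: "card (W j) \<le> 1" if "j < kd" for j
  proof -
    have i: "Drone j \<in> fleet (star kt kd \<alpha> n)" using Drone[OF that] by (simp add: N_def)
    have \<sigma>: "1 / real m = speed (star kt kd \<alpha> n) (Drone j)" using \<alpha> by simp
    have m0: "0 < 1 / real m" using m by simp
    note kin = x' i \<sigma> m0
    \<comment> \<open>The first leaf is reached at time \<open>m\<close> at the earliest, a second
      one at least \<open>2 * m\<close> later.\<close>
    have far: "\<not> t < 3 * real m"
      if "s \<le> t" "0 \<le> s" "x (Drone j) s = at_node u" "x (Drone j) t = at_node v"
        "u \<noteq> v" "0 < u" "0 < v" for s t u v
    proof -
      have "1 \<le> 1 / real m * s" by (rule star_outbound[OF kin that(2,3,6)])
      moreover have "2 \<le> 1 / real m * (t - s)"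
        by (rule star_leaf_to_leaf[OF kin that(2,1,3,4,6,7,5)])
      ultimately show ?thesis using m by (simp add: field_simps)
    qed
    have "u = v" if uv: "u \<in> W j" "v \<in> W j" for u v
    proof (rule ccontr)
      assume ne: "u \<noteq> v"
      obtain p q where "0 \<le> p" "p < 3 * real m" "x (Drone j) p = at_node u"
        "0 \<le> q" "q < 3 * real m" "x (Drone j) q = at_node v" "0 < u" "0 < v"
        using uv unfolding W_def by auto
      then show False using far[of p q u v] far[of q p v u] ne by (cases "p \<le> q") auto
    qed
    moreover have "finite (W j)" by (simp add: W_def)
    ultimately show ?thesis by (simp add: card_le_Suc0_iff_eq)
  qed
  have card_W: "card (\<Union>j \<in> J. W j) \<le> card J" if "J \<subseteq> {..<kd}" for J
  proof -
    have "finite J" using that finite_subset by blast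
    then have "card (\<Union>j \<in> J. W j) \<le> (\<Sum>j \<in> J. card (W j))" by (rule card_UN_le)
    also have "\<dots> \<le> (\<Sum>j \<in> J. 1)" using W that by (intro sum_mono) auto
    finally show ?thesis by simp
  qed
  have finW: "finite (\<Union>j \<in> J. W j)" for J
    by (rule finite_subset[of _ "{1..n}"]) (auto simp: W_def)

  \<comment> \<open>Size of the damage set and bounds on the optimum\<close>
  have visited: "\<exists>i \<in> fleet N. \<exists>t \<ge> 0. x i t = at_node v" if "v \<in> {1..n}" for v
  proof -
    have "v \<in> (\<Union>i \<in> fleet N. \<Union>t \<in> {0..}. visited_until (x i) t)"
      using serves that unfolding serves_def customers by blast
    then show ?thesis unfolding visited_until_def by blast
  qed
  have "D \<subseteq> (\<Union>j \<in> {..<s}. W j)"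
  proof
    fix v assume "v \<in> D"
    then have v: "v \<in> {1..n}" "Q x v" using D DQ by auto
    obtain i where "i \<in> fleet N" "x i (first_visit N x v) = at_node v"
      using visited[OF v(1)] first_visit_attained[OF x] by blast
    then show "v \<in> (\<Union>j \<in> {..<s}. W j)" using v by (auto simp: Q_def W_def)
  qed
  then have "card D \<le> card (\<Union>j \<in> {..<s}. W j)" by (intro card_mono finW)
  also have "\<dots> \<le> s" using card_W[of "{..<s}"] by (simp add: s_def)
  finally have cardD: "card D \<le> kt * m" by (simp add: s_def)
  have OPT: "1 \<le> OPT N D" "OPT N D \<le> 2 * real m"
    using OPT_star[OF assms(1,2) m n_def D cardD] by (simp_all add: N_def \<alpha>)

  \<comment> \<open>Lower bound on the completion time\<close>
  define r where "r = \<lceil>real kd / real kt\<rceil>"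
  \<comment> \<open>The two terms are \<open>2\<close> and \<open>1 + r * \<alpha>\<close> times the
    bound \<open>2 * m\<close> on the optimum.\<close>
  have bound: "min (4 * real m) (2 * (real m + of_int r)) \<le> T" if T: "returned N x T" for T
  proof (rule ccontr)
    assume "\<not> ?thesis"
    then have T4: "T < 4 * real m" and Tr: "T < 2 * (real m + of_int r)" by auto
    have T: "0 \<le> T" "\<And>i t. i \<in> fleet N \<Longrightarrow> T \<le> t \<Longrightarrow> x i t = at_node 0"
      using T by (auto simp: returned_def N_def)
    have before: "t < T" if "i \<in> fleet N" "x i t = at_node v" "v \<in> {1..n}" for i t v
      using T(2)[OF that(1)] that by (force simp: not_less[symmetric])
    \<comment> \<open>The way back takes a drone time \<open>m\<close>, and it has to end before
      \<open>4 * m\<close>.\<close>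
    have drone_early: "t < 3 * real m"
      if j: "j < kd" "0 \<le> t" "x (Drone j) t = at_node v" "v \<in> {1..n}" for j t v
    proof -
      have i: "Drone j \<in> fleet (star kt kd \<alpha> n)" using Drone[OF j(1)] by (simp add: N_def)
      have \<sigma>: "1 / real m = speed (star kt kd \<alpha> n) (Drone j)" using \<alpha> by simp
      have m0: "0 < 1 / real m" using m by simp
      have "t \<le> T" "0 < v" using before[OF Drone[OF j(1)] j(3,4)] j by auto
      then have "1 \<le> 1 / real m * (T - t)"
        using star_inbound[OF x' i \<sigma> m0 j(2) _ j(3)] T(2)[OF Drone[OF j(1)]] by blast
      then show ?thesis using m T4 by (simp add: field_simps)
    qed
    define V where "V k = {v \<in> {1..n}. \<exists>t \<ge> 0. x (Truck k) t = at_node v}" for k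
    \<comment> \<open>An upper bound for the leaves one truck can visit by \<open>T\<close>, at 2
      units of time each, rounded down.\<close>
    define c where "c = nat \<lfloor>T / 2\<rfloor>"
    have c: "2 * real c \<le> T" using T(1) by (simp add: c_def) linarith
    have V: "card (V k) \<le> c" if k: "k < kt" for k
    proof (cases "V k = {}")
      case False
      have i: "Truck k \<in> fleet (star kt kd \<alpha> n)" using Truck[OF k] by (simp add: N_def)
      have \<sigma>: "1 = speed (star kt kd \<alpha> n) (Truck k)" by simp
      have late: "t \<le> T - 1" if "0 \<le> t" "x (Truck k) t = at_node v" "v \<in> {1..n}" for t v
        using star_inbound[OF x' i \<sigma> zero_less_one that(1) _ that(2), of T]
          before[OF Truck[OF k] that(2,3)] T(2)[OF Truck[OF k]] that(3) by auto
      from False obtain v t where vt: "0 \<le> t" "x (Truck k) t = at_node v" "v \<in> {1..n}"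
        unfolding V_def by blast
      \<comment> \<open>The deadline \<open>T - 1\<close> for leaf visits accounts for the way back;
        it is nonnegative because this truck visits some leaf.\<close>
      have "2 * real (card (V k)) \<le> 1 * (T - 1) + 1"
      proof (rule star_card_visited[OF x' i \<sigma> zero_less_one])
        show "0 \<le> T - 1" using late[OF vt] vt by simp
        show "\<exists>t. 0 \<le> t \<and> t \<le> T - 1 \<and> x (Truck k) t = at_node v" if "v \<in> V k" for v
          using that late unfolding V_def by blast
      qed (auto simp: V_def)
      then have "real (card (V k)) \<le> T / 2" by simp
      then show ?thesis unfolding c_def by linarith
    qed simp
    \<comment> \<open>A leaf visited by no truck must be undamaged. Were it also missed by the
      unselected drones, its first visitors would all be selected drones, and \<open>Q\<close> would
      have damaged it.\<close>
    have "{1..n} \<subseteq> (\<Union>k \<in> {..<kt}. V k) \<union> (\<Union>j \<in> {s..<kd}. W j)"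
    proof
      fix v assume v: "v \<in> {1..n}"
      show "v \<in> (\<Union>k \<in> {..<kt}. V k) \<union> (\<Union>j \<in> {s..<kd}. W j)"
      proof (rule ccontr)
        assume contr: "\<not> ?thesis"
        then have noV: "\<And>k t. k < kt \<Longrightarrow> 0 \<le> t \<Longrightarrow> x (Truck k) t \<noteq> at_node v"
          and noW: "\<And>j. s \<le> j \<Longrightarrow> j < kd \<Longrightarrow> v \<notin> W j" using v by (auto simp: V_def)
        have "v \<notin> D"
        proof
          assume "v \<in> D"
          then obtain i t where "i \<in> truck_fleet N" "v \<in> visited_until (x i) t"
            using serves unfolding serves_def by blast
          then show False using noV by (auto simp: N_def truck_fleet_star visited_until_def)
        qed
        let ?t = "first_visit N x v"
        obtain i where i: "0 \<le> ?t" "i \<in> fleet N" "x i ?t = at_node v"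
          using visited[OF v] first_visit_attained[OF x] by blast
        \<comment> \<open>\<open>Q\<close> fails if any other vehicle arrives simultaneously, so
          every vehicle present at the first visit is examined.\<close>
        have "i \<in> Drone ` {..<s} \<and> ?t < 3 * real m"
          if i': "i \<in> fleet N" "x i ?t = at_node v" for i
        proof -
          obtain j where j: "i = Drone j" "j < kd"
            using i' noV i(1) by (auto simp: N_def fleet_star)
          then have early: "?t < 3 * real m" using drone_early i(1) i'(2) v by blast
          then have "v \<in> W j" using i(1) i'(2) v j(1) by (auto simp: W_def)
          then have "j < s" using noW j(2) by (meson not_less)
          then show ?thesis using j(1) early by simp
        qed
        then have "Q x v" using i unfolding Q_def by blast
        with DQ[OF v] \<open>v \<notin> D\<close> show False by simp
      qed
    qed
    then have "card {1..n} \<le> card ((\<Union>k \<in> {..<kt}. V k) \<union> (\<Union>j \<in> {s..<kd}. W j))"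
      by (intro card_mono) (auto simp: V_def W_def)
    also have "\<dots> \<le> card (\<Union>k \<in> {..<kt}. V k) + card (\<Union>j \<in> {s..<kd}. W j)" by (rule card_Un_le)
    also have "card (\<Union>j \<in> {s..<kd}. W j) \<le> kd - s"
      using card_W[of "{s..<kd}"] by (simp add: subset_iff)
    also have "card (\<Union>k \<in> {..<kt}. V k) \<le> (\<Sum>k<kt. card (V k))" by (intro card_UN_le) simp
    also have "\<dots> \<le> (\<Sum>k<kt. c)" using V by (intro sum_mono) auto
    finally have "kt * m + kd \<le> kt * c + (kd - s)" by (simp add: n_def)
    then have *: "kt * m + s \<le> kt * c" by (simp add: s_def)
    \<comment> \<open>If \<open>s = kd\<close>, the count gives \<open>kd / kt \<le> c - m\<close>,
      and integrality of the right-hand side brings in the ceiling \<open>r\<close>. If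
      \<open>s = kt * m\<close>, it gives \<open>c \<ge> 2 * m\<close>, against
      \<open>T < 4 * m\<close>.\<close>
    show False
    proof (cases "kd \<le> kt * m")
      case True
      then have "kt * m + kd \<le> kt * c" using * by (simp add: s_def)
      then have "real kt * real m + real kd \<le> real kt * real c"
        by (metis of_nat_add of_nat_le_iff of_nat_mult)
      then have "real kd / real kt \<le> real c - real m"
        using assms(1) by (simp add: field_simps)
      then have "r \<le> int c - int m" unfolding r_def by (simp add: ceiling_le_iff)
      then have "real m + real_of_int r \<le> real c" by linarith
      then have "2 * (real m + real_of_int r) \<le> 2 * real c" by (rule mult_left_mono) simp
      also note c
      also note Tr
      finally show False by simp
    next
      case False
      then have "kt * m + kt * m \<le> kt * c" using * by (simp add: s_def)
      then have "kt * (2 * m) \<le> kt * c" by (simp only: mult_2 distrib_left)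
      then have "2 * m \<le> c" unfolding mult_le_cancel1 using assms(1) by linarith
      then show False using c T4 by linarith
    qed
  qed

  \<comment> \<open>The competitive ratio\<close>
  have "ALG \<pi> N D = Inf {T. returned N x T}" by (rule ALG_eq[OF N x])
  also have "\<dots> \<ge> min (4 * real m) (2 * (real m + of_int r))"
    using T0 bound by (intro cInf_greatest) auto
  finally have ALG: "min (4 * real m) (2 * (real m + of_int r)) \<le> ALG \<pi> N D" .
  have "0 \<le> real kd / real kt" by simp
  then have r0: "0 \<le> r" unfolding r_def by linarith
  have "min 2 (1 + of_int r * \<alpha>) * OPT N D \<le> min 2 (1 + of_int r * \<alpha>) * (2 * real m)"
    using OPT(2) r0 assms(3) by (intro mult_left_mono) auto
  also have "\<dots> = min (2 * (2 * real m)) ((1 + of_int r * \<alpha>) * (2 * real m))"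
    by (subst min_mult_distrib_right) simp
  also have "(1 + of_int r * \<alpha>) * (2 * real m) = 2 * (real m + of_int r)"
    using m by (simp add: \<alpha> field_simps)
  also have "min (2 * (2 * real m)) (2 * (real m + of_int r)) \<le> ALG \<pi> N D" using ALG by simp
  finally have "min 2 (1 + of_int r * \<alpha>) \<le> ALG \<pi> N D / OPT N D"
    using OPT(1) by (simp only: pos_le_divide_eq)
  moreover have "rdp_instance N D" using N D by (simp add: rdp_instance_def customers)
  ultimately show ?thesis
    by (intro exI[of _ N] exI[of _ D]) (simp add: N_def r_def)
qed

end
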